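(* Let $(\Omega,\mathfrak{F},\mathrm{P})$ be a probability space, let $X$ be a random variable with range $\mathcal{X}$, and let $Y$ be a random variable with range $\mathcal{Y}\subseteq\mathbb{R}$ and $\mathrm{V}(Y)<+\infty$. Then $$\eta(X,Y)=\sup\left\{\rho\bigl(Y,\phi(X)\bigr)\ \middle|\ \phi\in\mathbb{R}^{\mathcal{X}}\text{ measurable},\ 0<\mathrm{V}(\phi(X))<+\infty\right\}.$$
   Context: $\mathrm{E}$, $\mathrm{V}$ and $\mathrm{C}$ denote expectation, variance and covariance under $\mathrm{P}$. The correlation ratio $\eta(X,Y)\ge 0$ is the nonnegative square root of $$\eta^2(X,Y)=\frac{\mathrm{V}(\mathrm{E}[Y\mid X])}{\mathrm{V}(Y)},$$ whose definition presupposes $\mathrm{V}(Y)>0$. The linear correlation coefficient of two real random variables $U,V$ is $$\rho(U,V)=\frac{\mathrm{C}(U,V)}{\sqrt{\mathrm{V}(U)}\sqrt{\mathrm{V}(V)}}.$$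
   Formalization: If no measurable φ has 0 < V(φ(X)) < +∞ (for example X almost surely constant), the set is empty and its supremum is not η = 0; the formal statement takes the supremum to be 0 in that case. V(Y) > 0 is assumed, as the definition of η requires. *)

theory Defs
  imports "HOL-Probability.Probability"
begin

context prob_space
begin

(* The Bochner integral of a non-integrable function is 0, so a value of variance is
   meaningful only together with this predicate. *)
definition finite_variance :: "('a \<Rightarrow> real) \<Rightarrow> bool" where
  "finite_variance U \<longleftrightarrow>
     integrable M U \<and> integrable M (\<lambda>\<omega>. (U \<omega> - expectation U)\<^sup>2)"

definition covariance :: "('a \<Rightarrow> real) \<Rightarrow> ('a \<Rightarrow> real) \<Rightarrow> real" where
  "covariance U V = expectation (\<lambda>\<omega>. (U \<omega> - expectation U) * (V \<omega> - expectation V))"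

definition linear_correlation :: "('a \<Rightarrow> real) \<Rightarrow> ('a \<Rightarrow> real) \<Rightarrow> real" where
  "linear_correlation U V = covariance U V / (sqrt (variance U) * sqrt (variance V))"

definition cond_expectation :: "'b measure \<Rightarrow> ('a \<Rightarrow> real) \<Rightarrow> ('a \<Rightarrow> 'b) \<Rightarrow> 'a \<Rightarrow> real" where
  "cond_expectation N Y X = real_cond_exp M (vimage_algebra (space M) X N) Y"

definition correlation_ratio :: "'b measure \<Rightarrow> ('a \<Rightarrow> 'b) \<Rightarrow> ('a \<Rightarrow> real) \<Rightarrow> real" where
  "correlation_ratio N X Y = sqrt (variance (cond_expectation N Y X) / variance Y)"

definition transform_correlations :: "'b measure \<Rightarrow> ('a \<Rightarrow> 'b) \<Rightarrow> ('a \<Rightarrow> real) \<Rightarrow> real set" where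
  "transform_correlations N X Y =
     {linear_correlation Y (\<lambda>\<omega>. \<phi> (X \<omega>)) | \<phi>.
        \<phi> \<in> borel_measurable N \<and>
        finite_variance (\<lambda>\<omega>. \<phi> (X \<omega>)) \<and> 0 < variance (\<lambda>\<omega>. \<phi> (X \<omega>))}"

end

end

theory Submission
  imports Defs
begin

text \<open>
  Put \<open>E = E[Y | X]\<close>. For square-integrable \<open>\<phi>(X)\<close> the defining property of conditional
  expectation gives \<open>C(Y, \<phi>(X)) = C(E, \<phi>(X))\<close>, so Cauchy-Schwarz bounds \<open>\<bar>\<rho>(Y, \<phi>(X))\<bar>\<close> by
  \<open>\<eta>(X, Y)\<close>. If \<open>V(E) > 0\<close>, the bound is attained at a measurable \<open>\<phi>\<close> with \<open>\<phi>(X) = E\<close>, which exists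
  by Doob-Dynkin factorization; if \<open>V(E) = 0\<close>, every admissible correlation vanishes.
\<close>

section \<open>Doob-Dynkin factorization\<close>

text \<open>Every strict rational sublevel set of \<open>g\<close> is the preimage under
  \<open>X\<close> of some measurable \<open>A q\<close>, and a real number is the infimum of the
  rationals above it. So \<open>g\<close> is recovered from the countable family
  \<open>A\<close>.\<close>

lemma borel_measurable_vimage_algebra_factor:
  fixes g :: "'a \<Rightarrow> real"
  assumes X: "X \<in> \<Omega> \<rightarrow> space N"
    and g: "g \<in> borel_measurable (vimage_algebra \<Omega> X N)"
  obtains \<phi> where "\<phi> \<in> borel_measurable N" "\<And>\<omega>. \<omega> \<in> \<Omega> \<Longrightarrow> \<phi> (X \<omega>) = g \<omega>"
proof -
  have "\<exists>A\<in>sets N. {\<omega>\<in>\<Omega>. g \<omega> < real_of_rat q} = X -` A \<inter> \<Omega>" for q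
  proof -
    have "{\<omega>\<in>space (vimage_algebra \<Omega> X N). g \<omega> < real_of_rat q} \<in> sets (vimage_algebra \<Omega> X N)"
      using g by measurable
    then show ?thesis
      by (auto simp: sets_vimage_algebra2[OF X])
  qed
  then obtain A where A: "\<And>q. A q \<in> sets N"
    and A_eq: "\<And>q. {\<omega>\<in>\<Omega>. g \<omega> < real_of_rat q} = X -` A q \<inter> \<Omega>"
    by metis
  \<comment> \<open>The value \<infinity> discards each \<open>q\<close> with \<open>x\<close>
    outside \<open>A q\<close>. Off the range of \<open>X\<close> the infimum may be infinite, hence
    the detour through \<open>ereal\<close>.\<close>
  define \<psi> where "\<psi> x = (INF q. if x \<in> A q then ereal (real_of_rat q) else \<infinity>)" for x
  have "\<psi> \<in> borel_measurable N"
    unfolding \<psi>_def using A by (intro borel_measurable_INF measurable_If_set) auto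
  then have "(\<lambda>x. real_of_ereal (\<psi> x)) \<in> borel_measurable N"
    by measurable
  moreover have "\<psi> (X \<omega>) = ereal (g \<omega>)" if "\<omega> \<in> \<Omega>" for \<omega>
  proof -
    have mem: "X \<omega> \<in> A q \<longleftrightarrow> g \<omega> < real_of_rat q" for q
      using A_eq[of q] that by blast
    show ?thesis
    proof (rule antisym)
      show "ereal (g \<omega>) \<le> \<psi> (X \<omega>)"
        unfolding \<psi>_def by (rule INF_greatest) (simp add: mem)
      show "\<psi> (X \<omega>) \<le> ereal (g \<omega>)"
      proof (rule dense_ge)
        fix y assume "ereal (g \<omega>) < y"
        \<comment> \<open>A real \<open>z\<close> is interposed because \<open>y\<close> may be
          \<infinity>; there \<open>g \<omega> + 1\<close> serves.\<close>
        then obtain z where z: "g \<omega> < z" "ereal z \<le> y"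
          by (cases y) (auto intro: that[of "g \<omega> + 1"])
        obtain q where q: "g \<omega> < real_of_rat q" "real_of_rat q < z"
          using of_rat_dense[OF z(1)] by blast
        have "\<psi> (X \<omega>) \<le> (if X \<omega> \<in> A q then ereal (real_of_rat q) else \<infinity>)"
          unfolding \<psi>_def by (rule INF_lower) simp
        also have "\<dots> \<le> y"
          using q z by (simp add: mem order.trans[OF _ z(2)])
        finally show "\<psi> (X \<omega>) \<le> y" .
      qed
    qed
  qed
  ultimately show thesis
    by (intro that[of "\<lambda>x. real_of_ereal (\<psi> x)"]) auto
qed

section \<open>Products of square-integrable functions\<close>

lemma integrable_mult_of_squares:
  fixes f g :: "'a \<Rightarrow> real"
  assumes [measurable]: "f \<in> borel_measurable M" "g \<in> borel_measurable M"
    and "integrable M (\<lambda>x. (f x)\<^sup>2)" "integrable M (\<lambda>x. (g x)\<^sup>2)"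
  shows "integrable M (\<lambda>x. f x * g x)"
proof (rule Bochner_Integration.integrable_bound[OF Bochner_Integration.integrable_add[OF assms(3,4)]])
  have "\<bar>a * b\<bar> \<le> a\<^sup>2 + b\<^sup>2" for a b :: real
    using sum_squares_bound[of "\<bar>a\<bar>" "\<bar>b\<bar>"] abs_ge_zero[of "a * b"]
    unfolding abs_mult power2_abs by linarith
  then show "AE x in M. norm (f x * g x) \<le> norm ((f x)\<^sup>2 + (g x)\<^sup>2)"
    by simp
qed measurable

text \<open>The integral of \<open>(f x - t * g x)\<^sup>2\<close> is a nonnegative quadratic in
  \<open>t\<close>; its value at the minimizer \<open>t = b / c\<close> is
  \<open>a - b\<^sup>2 / c\<close>.\<close>

lemma Cauchy_Schwarz_integral:
  fixes f g :: "'a \<Rightarrow> real"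
  assumes meas: "f \<in> borel_measurable M" "g \<in> borel_measurable M"
    and f: "integrable M (\<lambda>x. (f x)\<^sup>2)" and g: "integrable M (\<lambda>x. (g x)\<^sup>2)"
    and pos: "0 < (\<integral>x. (g x)\<^sup>2 \<partial>M)"
  shows "(\<integral>x. f x * g x \<partial>M)\<^sup>2 \<le> (\<integral>x. (f x)\<^sup>2 \<partial>M) * (\<integral>x. (g x)\<^sup>2 \<partial>M)"
proof -
  note fg = integrable_mult_of_squares[OF meas f g]
  define a b c where "a = (\<integral>x. (f x)\<^sup>2 \<partial>M)" "b = (\<integral>x. f x * g x \<partial>M)" "c = (\<integral>x. (g x)\<^sup>2 \<partial>M)"
  define t where "t = b / c"
  have c: "0 < c"
    using pos by (simp add: a_b_c_def)
  have "0 \<le> (\<integral>x. (f x - t * g x)\<^sup>2 \<partial>M)"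
    by simp
  also have "\<dots> = (\<integral>x. (f x)\<^sup>2 - 2 * t * (f x * g x) + t\<^sup>2 * (g x)\<^sup>2 \<partial>M)"
    by (simp add: power2_eq_square algebra_simps)
  also have "\<dots> = a - 2 * t * b + t\<^sup>2 * c"
    using f g fg by (simp add: a_b_c_def)
  also have "\<dots> = a - b\<^sup>2 / c"
    using c by (simp add: t_def field_simps power2_eq_square)
  finally show ?thesis
    using c by (simp add: field_simps flip: a_b_c_def)
qed

context prob_space
begin

section \<open>Covariance and conditional expectation\<close>

lemma finite_variance_iff_square_integrable:
  "finite_variance U \<longleftrightarrow> U \<in> borel_measurable M \<and> integrable M (\<lambda>\<omega>. (U \<omega>)\<^sup>2)"
proof (intro iffI conjI)
  assume fv: "finite_variance U"
  then have U: "integrable M U" and var: "integrable M (\<lambda>\<omega>. (U \<omega> - expectation U)\<^sup>2)"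
    by (auto simp: finite_variance_def)
  show "U \<in> borel_measurable M"
    using U by simp
  have "integrable M (\<lambda>\<omega>. (U \<omega> - expectation U)\<^sup>2 + 2 * expectation U * U \<omega> - (expectation U)\<^sup>2)"
    using U var by simp
  then show "integrable M (\<lambda>\<omega>. (U \<omega>)\<^sup>2)"
    by (simp add: power2_diff mult.commute mult.left_commute)
next
  assume *: "U \<in> borel_measurable M \<and> integrable M (\<lambda>\<omega>. (U \<omega>)\<^sup>2)"
  then have "integrable M U"
    by (blast intro: square_integrable_imp_integrable)
  with * show "finite_variance U"
    by (simp add: finite_variance_def power2_diff)
qed

lemma finite_varianceD:
  assumes "finite_variance U"
  shows "U \<in> borel_measurable M" "integrable M U" "integrable M (\<lambda>\<omega>. (U \<omega>)\<^sup>2)"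
    and "integrable M (\<lambda>\<omega>. (U \<omega> - expectation U)\<^sup>2)"
  using assms finite_variance_iff_square_integrable by (auto simp: finite_variance_def)

text \<open>Centring one factor is enough, since the centred \<open>V\<close> has mean zero against
  the constant \<open>expectation U\<close>. This leaves \<open>U\<close> bare, ready to be
  exchanged for a conditional expectation.\<close>

lemma covariance_eq:
  assumes U: "finite_variance U" and V: "finite_variance V"
  shows "covariance U V = expectation (\<lambda>\<omega>. (V \<omega> - expectation V) * U \<omega>)"
proof -
  have int: "integrable M U" "integrable M V" "integrable M (\<lambda>\<omega>. U \<omega> * V \<omega>)"
    using U V by (simp_all add: finite_varianceD integrable_mult_of_squares)
  have "covariance U V = expectation (\<lambda>\<omega>. (V \<omega> - expectation V) * U \<omega>
      - (V \<omega> - expectation V) * expectation U)"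
    unfolding covariance_def by (simp add: algebra_simps)
  also have "\<dots> = expectation (\<lambda>\<omega>. (V \<omega> - expectation V) * U \<omega>)
      - expectation (\<lambda>\<omega>. (V \<omega> - expectation V) * expectation U)"
    using int by (intro Bochner_Integration.integral_diff) (auto simp: algebra_simps)
  also have "expectation (\<lambda>\<omega>. (V \<omega> - expectation V) * expectation U) = 0"
    using int by (simp add: prob_space)
  finally show ?thesis
    by simp
qed

lemma covariance_power2_le:
  assumes U: "finite_variance U" and V: "finite_variance V" and pos: "0 < variance V"
  shows "(covariance U V)\<^sup>2 \<le> variance U * variance V"
  unfolding covariance_def
  using assms by (intro Cauchy_Schwarz_integral) (auto simp: finite_variance_def)

text \<open>Conditional Jensen for the convex function squaring.\<close>

lemma finite_variance_real_cond_exp: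
  assumes "subalgebra M F" and Y: "finite_variance Y"
  shows "finite_variance (real_cond_exp M F Y)"
proof -
  interpret finite_measure_subalgebra M F
    by unfold_locales fact
  have "integrable M (\<lambda>\<omega>. (real_cond_exp M F Y \<omega>)\<^sup>2)"
    by (rule integrable_convex_cond_exp[where I = UNIV])
      (use Y in \<open>simp_all add: finite_varianceD convex_power2\<close>)
  then show ?thesis
    by (simp add: finite_variance_iff_square_integrable)
qed

text \<open>By \<open>covariance_eq\<close> both sides are integrals against the weight
  \<open>U \<omega> - expectation U\<close>. It is \<open>F\<close>-measurable, so the defining
  property of conditional expectation applies.\<close>

lemma covariance_real_cond_exp:
  assumes sub: "subalgebra M F" and Y: "finite_variance Y" and U: "finite_variance U"
    and U_F: "U \<in> borel_measurable F"
  shows "covariance (real_cond_exp M F Y) U = covariance Y U"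
proof -
  interpret finite_measure_subalgebra M F
    by unfold_locales fact
  have Y_meas: "Y \<in> borel_measurable M" and int: "integrable M (\<lambda>\<omega>. (U \<omega> - expectation U) * Y \<omega>)"
    using Y U by (auto simp: finite_varianceD intro!: integrable_mult_of_squares borel_measurable_diff)
  have "expectation (\<lambda>\<omega>. (U \<omega> - expectation U) * real_cond_exp M F Y \<omega>)
      = expectation (\<lambda>\<omega>. (U \<omega> - expectation U) * Y \<omega>)"
    using U_F Y_meas int by (intro real_cond_exp_intg(2)) auto
  then show ?thesis
    by (simp add: covariance_eq U Y finite_variance_real_cond_exp[OF sub])
qed

section \<open>The upper bound and its attainment\<close>

lemma subalgebra_vimage_algebra:
  assumes "X \<in> measurable M N"
  shows "subalgebra M (vimage_algebra (space M) X N)"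
  using assms by (simp add: subalgebra_def measurable_iff_sets)

lemma abs_linear_correlation_le_correlation_ratio:
  assumes X: "X \<in> measurable M N" and Y: "finite_variance Y"
    and \<phi>: "\<phi> \<in> borel_measurable N"
    and U: "finite_variance (\<lambda>\<omega>. \<phi> (X \<omega>))" and pos: "0 < variance (\<lambda>\<omega>. \<phi> (X \<omega>))"
  shows "\<bar>linear_correlation Y (\<lambda>\<omega>. \<phi> (X \<omega>))\<bar> \<le> correlation_ratio N X Y"
proof -
  let ?U = "\<lambda>\<omega>. \<phi> (X \<omega>)" and ?F = "vimage_algebra (space M) X N"
  let ?E = "real_cond_exp M ?F Y"
  note sub = subalgebra_vimage_algebra[OF X]
  have "X \<in> measurable ?F N"
    using X by (intro measurable_vimage_algebra1) (auto dest: measurable_space)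
  then have U_F: "?U \<in> borel_measurable ?F"
    using \<phi> by measurable
  \<comment> \<open>Replacing \<open>Y\<close> by \<open>?E\<close> before Cauchy-Schwarz sharpens
    the factor \<open>variance Y\<close> to \<open>variance ?E\<close>.\<close>
  have "(covariance Y ?U)\<^sup>2 \<le> variance ?E * variance ?U"
    using covariance_power2_le[OF finite_variance_real_cond_exp[OF sub Y] U pos]
    by (simp add: covariance_real_cond_exp[OF sub Y U U_F])
  then have "\<bar>covariance Y ?U\<bar> \<le> sqrt (variance ?E) * sqrt (variance ?U)"
    by (metis real_sqrt_abs real_sqrt_le_mono real_sqrt_mult)
  moreover have "\<bar>linear_correlation Y ?U\<bar>
      = \<bar>covariance Y ?U\<bar> / sqrt (variance ?U) / sqrt (variance Y)"
    by (simp add: linear_correlation_def abs_mult)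
  moreover have "correlation_ratio N X Y = sqrt (variance ?E) / sqrt (variance Y)"
    by (simp add: correlation_ratio_def cond_expectation_def real_sqrt_divide)
  \<comment> \<open>Here \<open>variance Y\<close> is only known to be nonnegative; if it is 0, both
    quotients are 0 by the convention for division.\<close>
  ultimately show ?thesis
    using pos variance_positive[of Y]
    by (simp only: real_sqrt_gt_0_iff real_sqrt_ge_0_iff divide_right_mono pos_divide_le_eq)
qed

lemma correlation_ratio_in_transform_correlations:
  assumes X: "X \<in> measurable M N" and Y: "finite_variance Y"
    and pos: "0 < correlation_ratio N X Y"
  shows "correlation_ratio N X Y \<in> transform_correlations N X Y"
proof -
  let ?F = "vimage_algebra (space M) X N"
  let ?E = "real_cond_exp M ?F Y"
  note sub = subalgebra_vimage_algebra[OF X]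
  note E = finite_variance_real_cond_exp[OF sub Y]
  have X_space: "X \<in> space M \<rightarrow> space N"
    using X by (auto dest: measurable_space)
  obtain \<phi> where \<phi>: "\<phi> \<in> borel_measurable N" "\<And>\<omega>. \<omega> \<in> space M \<Longrightarrow> \<phi> (X \<omega>) = ?E \<omega>"
    using borel_measurable_vimage_algebra_factor[OF X_space borel_measurable_cond_exp] by blast
  let ?U = "\<lambda>\<omega>. \<phi> (X \<omega>)"
  have mean: "expectation ?U = expectation ?E"
    by (simp add: \<phi>(2) cong: Bochner_Integration.integral_cong)
  have var: "variance ?U = variance ?E"
    unfolding mean by (simp add: \<phi>(2) cong: Bochner_Integration.integral_cong)
  have cov: "covariance Y ?U = covariance Y ?E"
    unfolding covariance_def mean by (simp add: \<phi>(2) cong: Bochner_Integration.integral_cong)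
  have U: "finite_variance ?U"
    using E unfolding finite_variance_def mean
    by (simp add: \<phi>(2) cong: Bochner_Integration.integrable_cong)
  \<comment> \<open>The exchange of \<open>Y\<close> for \<open>?E\<close> is applied with
    \<open>?E\<close> itself as the second argument.\<close>
  have "covariance Y ?E = variance ?E"
    using covariance_real_cond_exp[OF sub Y E borel_measurable_cond_exp]
    by (simp add: covariance_def power2_eq_square)
  \<comment> \<open>A positive quotient with nonnegative denominator has a positive numerator; this
    makes \<phi> admissible.\<close>
  moreover have var_pos: "0 < variance ?E"
    using pos variance_positive[of Y]
    by (simp add: correlation_ratio_def cond_expectation_def zero_less_divide_iff)
  \<comment> \<open>The correlation is \<open>variance ?E\<close> over the product of the two
    standard deviations, and \<open>variance ?E / sqrt (variance ?E)\<close> is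
    \<open>sqrt (variance ?E)\<close>.\<close>
  ultimately have "linear_correlation Y ?U = correlation_ratio N X Y"
    unfolding linear_correlation_def correlation_ratio_def cond_expectation_def cov var
    by (simp add: real_sqrt_divide real_div_sqrt mult.commute[of "sqrt (variance Y)"]
        flip: divide_divide_eq_left)
  then show ?thesis
    unfolding transform_correlations_def using \<phi>(1) U var_pos var by (auto intro!: exI[of _ \<phi>])
qed

end

(* If every finite-variance \<phi>(X) is almost surely constant, no \<phi> is admissible; the supremum
   of the empty set is then read as 0. *)
theorem mainTheorem1:
  fixes M :: "'a measure" and N :: "'b measure"
    and X :: "'a \<Rightarrow> 'b" and Y :: "'a \<Rightarrow> real"
  assumes "prob_space M"
    and "X \<in> measurable M N"
    and "Y \<in> borel_measurable M"
    and "prob_space.finite_variance M Y"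
    and "0 < prob_space.variance M Y"
  shows "ereal (prob_space.correlation_ratio M N X Y) =
    (if prob_space.transform_correlations M N X Y = {} then 0
     else (SUP r \<in> prob_space.transform_correlations M N X Y. ereal r))"
proof -
  interpret prob_space M by fact
  let ?\<eta> = "correlation_ratio N X Y" and ?R = "transform_correlations N X Y"
  have bound: "\<bar>r\<bar> \<le> ?\<eta>" if "r \<in> ?R" for r
    using that abs_linear_correlation_le_correlation_ratio[OF assms(2,4)]
    by (auto simp: transform_correlations_def)
  have "0 \<le> ?\<eta>"
    using variance_positive by (simp add: correlation_ratio_def)
  then consider "?\<eta> = 0" "?R = {}" | "?\<eta> = 0" "?R \<noteq> {}" | "0 < ?\<eta>"
    by fastforce
  then show ?thesis
  proof cases
    case 1
    then show ?thesis by simp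
  next
    case 2
    \<comment> \<open>The bound squeezes every element to 0, and at least one exists.\<close>
    then have "?R = {0}"
      using bound by fastforce
    with 2 show ?thesis
      by (simp add: zero_ereal_def)
  next
    case 3
    then have mem: "?\<eta> \<in> ?R"
      by (rule correlation_ratio_in_transform_correlations[OF assms(2,4)])
    \<comment> \<open>The supremum is a maximum: the upper bound belongs to
      \<open>?R\<close>.\<close>
    have "(SUP r\<in>?R. ereal r) = ereal ?\<eta>"
    proof (rule antisym)
      show "(SUP r\<in>?R. ereal r) \<le> ereal ?\<eta>"
        using bound by (fastforce intro!: SUP_least)
      show "ereal ?\<eta> \<le> (SUP r\<in>?R. ereal r)"
        using mem by (rule SUP_upper)
    qed
    then show ?thesis
      using mem by auto
  qed
qed

end
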